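(* Let $Y_t=\mu_n\mathbf 1(a_n<t\le b_n)+\eta_t$, $t=1,\dots,n$, with $\eta_t$ iid standard Gaussian, integers $0\le a_n<b_n\le n$, $l_n=b_n-a_n$, $\mu_n\in\mathbb R$, and let $0<h_n\le n$ with $l_n\le h_n$. (i) If $\mu_n^2 l_n\left(\frac{l_n}{h_n}\right)\gg\log\left(\frac{en}{h_n}\right)$, then $T^{\mathrm{DS}}_{n,h_n}\to\infty$ in probability, and the test is consistent. (ii) If $\mu_n^2 l_n\left(\frac{l_n}{h_n}\right)=\mathcal O(1)$, then $T^{\mathrm{DS}}_{n,h_n}=\mathcal O_P(1)$, and the test fails to be consistent.
   Context: For real $0\le a<b\le n$ and $I=(a,b]$, $|I|=b-a$, put $T_n(I)=\left|\sum_{t\in I}Y_t\right|/\sqrt{|I|}$, where for non-integer $a,b$ the sum is extended by linear interpolation, i.e. $\sum_{t\in(a,b]}Y_t:=P(b)-P(a)$ with $P(x)=\sum_{t=1}^{\lfloor x\rfloor}Y_t+(x-\lfloor x\rfloor)Y_{\lfloor x\rfloor+1}$. With $\sigma^2=\mathrm{Var}(\eta_t)=1$, $$T_{n,h_n}^{\mathrm{DS}}=\sup_{|I|\ge h_n}\left\{T_n(I)-\sigma\sqrt{2\log(en/|I|)}\right\}_+,\qquad x_+=\max(x,0).$$ The test rejects for large values of $T_{n,h_n}^{\mathrm{DS}}$; consistency is understood as: for every fixed critical value $c>0$, $P(T_{n,h_n}^{\mathrm{DS}}>c)\to1$. For positive sequences, $x_n\gg y_n$ means $y_n/x_n\to0$.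 All limits are as $n\to\infty$. *)

theory Defs
  imports "HOL-Probability.Probability" "HOL-Library.Landau_Symbols"
begin

definition interp_sum :: "(nat \<Rightarrow> real) \<Rightarrow> real \<Rightarrow> real" where
  "interp_sum y x =
     (\<Sum>t=1..nat \<lfloor>x\<rfloor>. y t) + (x - of_int \<lfloor>x\<rfloor>) * y (nat \<lfloor>x\<rfloor> + 1)"

definition local_stat :: "(nat \<Rightarrow> real) \<Rightarrow> real \<Rightarrow> real \<Rightarrow> real" where
  "local_stat y u v = \<bar>interp_sum y v - interp_sum y u\<bar> / sqrt (v - u)"

text \<open>
  The data are \<open>y 1, ..., y n\<close>; the value \<open>y (n + 1)\<close> only enters with the weight 0. For
  \<open>0 < h \<le> n\<close> the index set is nonempty and the supremum, over real endpoints, is finite.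
\<close>

definition DS_stat :: "real \<Rightarrow> nat \<Rightarrow> real \<Rightarrow> (nat \<Rightarrow> real) \<Rightarrow> real" where
  "DS_stat \<sigma> n h y =
     (SUP (u, v) \<in> {(u, v). 0 \<le> u \<and> u < v \<and> v \<le> real n \<and> h \<le> v - u}.
        max (local_stat y u v - \<sigma> * sqrt (2 * ln (exp 1 * real n / (v - u)))) 0)"

text \<open>
  The positivity requirement matters because \<open>y / 0 = 0\<close> in HOL.
\<close>

definition much_larger :: "(nat \<Rightarrow> real) \<Rightarrow> (nat \<Rightarrow> real) \<Rightarrow> bool" where
  "much_larger x y \<longleftrightarrow>
     (\<forall>\<^sub>F n in sequentially. 0 < x n \<and> 0 < y n) \<and> (\<lambda>n. y n / x n) \<longlonglongrightarrow> 0"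

text \<open>
  The variable \<open>X n\<close> lives on its own probability space \<open>M n\<close>. Measurability is part of the next
  two notions, since a non-measurable set has \<open>measure\<close> 0.
\<close>

definition tends_to_infinity_in_prob ::
    "(nat \<Rightarrow> 'a measure) \<Rightarrow> (nat \<Rightarrow> 'a \<Rightarrow> real) \<Rightarrow> bool" where
  "tends_to_infinity_in_prob M X \<longleftrightarrow>
     (\<forall>\<^sub>F n in sequentially. X n \<in> borel_measurable (M n)) \<and>
     (\<forall>C. (\<lambda>n. \<P>(\<omega> in M n. X n \<omega> > C)) \<longlonglongrightarrow> 1)"

definition bounded_in_prob ::
    "(nat \<Rightarrow> 'a measure) \<Rightarrow> (nat \<Rightarrow> 'a \<Rightarrow> real) \<Rightarrow> bool" where
  "bounded_in_prob M X \<longleftrightarrow>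
     (\<forall>\<^sub>F n in sequentially. X n \<in> borel_measurable (M n)) \<and>
     (\<forall>\<epsilon>>0. \<exists>C. \<forall>\<^sub>F n in sequentially. \<P>(\<omega> in M n. \<bar>X n \<omega>\<bar> > C) \<le> \<epsilon>)"

definition consistent_test ::
    "(nat \<Rightarrow> 'a measure) \<Rightarrow> (nat \<Rightarrow> 'a \<Rightarrow> real) \<Rightarrow> bool" where
  "consistent_test M X \<longleftrightarrow> (\<forall>c>0. (\<lambda>n. \<P>(\<omega> in M n. X n \<omega> > c)) \<longlonglongrightarrow> 1)"

end

theory Submission
  imports Defs "HOL-Real_Asymp.Real_Asymp"
begin

text \<open>
  Detection only needs one interval of length \<open>h\<close> around the signal: there the statistic is at least
  \<open>\<bar>\<mu>\<bar> * l / sqrt h\<close> minus a sub-Gaussian error and the penalty \<open>sqrt (2 * ln (e * n / h))\<close>.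

  Conversely, the signal contributes at most \<open>\<bar>\<mu>\<bar> * l / sqrt h\<close> to any admissible interval, so it
  suffices that the penalised noise is tight uniformly in \<open>n\<close> and \<open>h\<close>. The interpolated partial sums,
  rescaled to \<open>[0, 1]\<close>, have increments that are sub-Gaussian with variance at most the length, like
  Brownian motion. The increments over all dyadic intervals \<open>[i / 2 ^ j, (i + r) / 2 ^ j]\<close> with
  \<open>r = O (j)\<close> exceed \<open>sqrt x * (sqrt (2 * ln (e / x)) + C)\<close>, with \<open>x = r / 2 ^ j\<close>, with probability at
  most a constant times \<open>exp (- C\<^sup>2 / 2)\<close>: the factor \<open>exp (- C * sqrt (2 * ln (e / x)))\<close> beats the
  number of lengths \<open>r\<close>, which is only polynomial in \<open>j\<close>. The case \<open>r = 1\<close> gives, by chaining, a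
  modulus of continuity, and the larger \<open>r\<close> give the sharp constant in front of the logarithm.
\<close>

section \<open>Interpolated sums and Gaussian increments\<close>

text \<open>\<open>cell_part x t\<close> is the length of the part of the unit cell \<open>(t - 1, t]\<close> that lies below \<open>x\<close>.\<close>

definition cell_part :: "real \<Rightarrow> nat \<Rightarrow> real" where
  "cell_part x t = max 0 (min 1 (x - real t + 1))"

text \<open>Cells up to the floor of \<open>x\<close> count fully, the next one by the fractional
  part, later ones not at all. Continuity, measurability and variance bounds of the interpolated sum
  are all read off from this linear form.\<close>

lemma interp_sum_eq_weighted:
  assumes "0 \<le> x" "x \<le> real n"
  shows "interp_sum y x = (\<Sum>t=1..n. cell_part x t * y t)"
proof -
  define k where "k = nat \<lfloor>x\<rfloor>"
  have k: "real k \<le> x" "x < real k + 1" "of_int \<lfloor>x\<rfloor> = real k"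
    using assms(1) by (auto simp: k_def)
  have "k \<le> n"
    using k assms by linarith
  have 1: "(\<Sum>t=1..k. cell_part x t * y t) = (\<Sum>t=1..k. y t)"
    using k by (intro sum.cong) (auto simp: cell_part_def max_def min_def)
  \<comment> \<open>When \<open>k = n\<close> there is no cell \<open>k + 1\<close> to split off,
    and \<open>y (n + 1)\<close> has weight 0.\<close>
  show ?thesis
  proof (cases "k = n")
    case True
    then have "x = real k" using assms k by linarith
    then show ?thesis
      using 1 True k(3) by (simp add: interp_sum_def flip: k_def)
  next
    case False
    then have kn: "k < n" using \<open>k \<le> n\<close> by simp
    have "(\<Sum>t=1..n. cell_part x t * y t) =
        (\<Sum>t\<in>{1..k} \<union> ({k+1} \<union> {k+2..n}). cell_part x t * y t)"
      using kn by (intro sum.cong) auto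
    also have "\<dots> = (\<Sum>t=1..k. cell_part x t * y t) +
        ((\<Sum>t\<in>{k+1}. cell_part x t * y t) + (\<Sum>t=k+2..n. cell_part x t * y t))"
      by (subst sum.union_disjoint, simp, simp, force, subst sum.union_disjoint) auto
    also have "(\<Sum>t=k+2..n. cell_part x t * y t) = 0"
      using k by (intro sum.neutral) (auto simp: cell_part_def max_def min_def)
    also have "(\<Sum>t\<in>{k+1}. cell_part x t * y t) = (x - real k) * y (k + 1)"
      using k by (simp add: cell_part_def max_def min_def)
    finally show ?thesis
      using 1 k(3) by (simp add: interp_sum_def flip: k_def)
  qed
qed

lemma interp_sum_diff_eq_weighted:
  assumes "0 \<le> u" "u \<le> v" "v \<le> real n"
  shows "interp_sum y v - interp_sum y u = (\<Sum>t=1..n. (cell_part v t - cell_part u t) * y t)"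
  using assms interp_sum_eq_weighted[of v n y] interp_sum_eq_weighted[of u n y]
  by (simp add: sum_subtractf left_diff_distrib)

lemma cell_part_diff_bounds:
  assumes "u \<le> v"
  shows "0 \<le> cell_part v t - cell_part u t" "cell_part v t - cell_part u t \<le> 1"
  using assms by (auto simp: cell_part_def max_def min_def)

text \<open>Evaluate the weighted form at the constant sequence 1, whose interpolated sum up to
  \<open>x\<close> is \<open>x\<close>.\<close>

lemma sum_cell_part_diff:
  assumes "0 \<le> u" "u \<le> v" "v \<le> real n"
  shows "(\<Sum>t=1..n. cell_part v t - cell_part u t) = v - u"
proof -
  have "interp_sum (\<lambda>_. 1) x = x" if "0 \<le> x" for x
    using that by (simp add: interp_sum_def)
  then show ?thesis
    using interp_sum_diff_eq_weighted[OF assms, of "\<lambda>_. 1"] assms by simp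
qed

text \<open>Weights in [0, 1] dominate their squares. The left side is the variance of an increment
  of standard noise; partial cells only lower it.\<close>

lemma sum_cell_part_diff_squared_le:
  assumes "0 \<le> u" "u \<le> v" "v \<le> real n"
  shows "(\<Sum>t=1..n. (cell_part v t - cell_part u t)\<^sup>2) \<le> v - u"
proof -
  have "(\<Sum>t=1..n. (cell_part v t - cell_part u t)\<^sup>2) \<le> (\<Sum>t=1..n. cell_part v t - cell_part u t)"
    using cell_part_diff_bounds[OF assms(2)]
    by (intro sum_mono) (simp add: power2_eq_square mult_left_le)
  then show ?thesis
    using sum_cell_part_diff[OF assms] by simp
qed

lemma continuous_on_cell_part: "continuous_on A (\<lambda>x. cell_part x t)"
  unfolding cell_part_def by (intro continuous_intros)

lemma continuous_on_interp_sum: "continuous_on {0..real n} (interp_sum y)"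
proof -
  have "continuous_on {0..real n} (\<lambda>x. \<Sum>t=1..n. cell_part x t * y t)"
    by (intro continuous_intros continuous_on_cell_part)
  then show ?thesis
    by (subst continuous_on_cong[OF refl interp_sum_eq_weighted]) auto
qed

lemma interp_sum_diff_signal:
  assumes "0 \<le> u" "u \<le> v" "v \<le> real n"
  shows "interp_sum (\<lambda>t. m * indicator {a<..b} t + e t) v -
      interp_sum (\<lambda>t. m * indicator {a<..b} t + e t) u =
    m * (\<Sum>t=1..n. (cell_part v t - cell_part u t) * indicator {a<..b} t) +
    (interp_sum e v - interp_sum e u)"
  unfolding interp_sum_diff_eq_weighted[OF assms]
  by (simp add: sum_distrib_left algebra_simps flip: sum.distrib)

text \<open>The sum is the length of the overlap of \<open>(u, v]\<close> with
  \<open>(a, b]\<close>.\<close>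

lemma signal_weight_bounds:
  assumes "u \<le> v" "a \<le> b" "b \<le> n"
  shows "0 \<le> (\<Sum>t=1..n. (cell_part v t - cell_part u t) * indicator {a<..b} t)"
    and "(\<Sum>t=1..n. (cell_part v t - cell_part u t) * indicator {a<..b} t) \<le> real b - real a"
proof -
  show "0 \<le> (\<Sum>t=1..n. (cell_part v t - cell_part u t) * indicator {a<..b} t)"
    using cell_part_diff_bounds[OF assms(1)] by (intro sum_nonneg mult_nonneg_nonneg) auto
  have "(\<Sum>t=1..n. (cell_part v t - cell_part u t) * indicator {a<..b} t)
      \<le> (\<Sum>t=1..n. indicator {a<..b} t)"
    using cell_part_diff_bounds[OF assms(1)] by (intro sum_mono) (auto simp: indicator_def)
  also have "\<dots> = (\<Sum>t\<in>{a<..b}. 1)"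
    using assms by (intro sum.mono_neutral_cong_right) (auto simp: indicator_def)
  also have "\<dots> = real b - real a"
    using assms by (simp add: of_nat_diff)
  finally show "(\<Sum>t=1..n. (cell_part v t - cell_part u t) * indicator {a<..b} t) \<le> real b - real a" .
qed

lemma signal_weight_full:
  assumes "u \<le> real a" "real b \<le> v" "a \<le> b" "b \<le> n"
  shows "(\<Sum>t=1..n. (cell_part v t - cell_part u t) * indicator {a<..b} t) = real b - real a"
proof -
  have "(\<Sum>t=1..n. (cell_part v t - cell_part u t) * indicator {a<..b} t) = (\<Sum>t\<in>{a<..b}. 1)"
    using assms
    by (intro sum.mono_neutral_cong_right)
      (auto simp: indicator_def cell_part_def max_def min_def)
  also have "\<dots> = real b - real a"
    using assms by (simp add: of_nat_diff)
  finally show ?thesis .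
qed

section \<open>Gaussian tail bounds\<close>

text \<open>Completing the square turns the tilted standard density into
  \<open>exp (c^2 / 2)\<close> times the normal density with mean \<open>c\<close>.\<close>

lemma std_normal_mgf:
  "(\<integral>\<^sup>+x. ennreal (std_normal_density x) * ennreal (exp (c * x)) \<partial>lborel) = ennreal (exp (c\<^sup>2 / 2))"
proof -
  have "std_normal_density x * exp (c * x) = exp (c\<^sup>2 / 2) * normal_density c 1 x" for x
  proof -
    have "exp (- x\<^sup>2 / 2) * exp (c * x) = exp (c\<^sup>2 / 2) * exp (- (x - c)\<^sup>2 / 2)"
      by (simp add: power2_eq_square field_simps flip: exp_add)
    then show ?thesis
      by (simp add: normal_density_def)
  qed
  then have "(\<integral>\<^sup>+x. ennreal (std_normal_density x) * ennreal (exp (c * x)) \<partial>lborel) =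
      (\<integral>\<^sup>+x. ennreal (exp (c\<^sup>2 / 2)) * ennreal (normal_density c 1 x) \<partial>lborel)"
    by (intro nn_integral_cong) (simp flip: ennreal_mult)
  also have "\<dots> = ennreal (exp (c\<^sup>2 / 2)) * (\<integral>\<^sup>+x. ennreal (normal_density c 1 x) \<partial>lborel)"
    by (intro nn_integral_cmult) auto
  also have "(\<integral>\<^sup>+x. ennreal (normal_density c 1 x) \<partial>lborel) = 1"
    by (subst nn_integral_eq_integral) auto
  finally show ?thesis by simp
qed

context prob_space
begin

text \<open>Chernoff's bound, with a moment generating function that factorises by independence. An
  upper bound \<open>V\<close> on the variance is enough, so increments can be measured against
  their length.\<close>

lemma gaussian_sum_upper_tail:
  fixes X :: "'i \<Rightarrow> 'a \<Rightarrow> real"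
  assumes fin: "finite I" and indep: "indep_vars (\<lambda>_. borel) X I"
    and gauss: "\<And>i. i \<in> I \<Longrightarrow> distributed M lborel (X i) std_normal_density"
    and V: "0 < V" "(\<Sum>i\<in>I. (w i)\<^sup>2) \<le> V" and lam: "0 < lam"
  shows "prob {x\<in>space M. lam * sqrt V \<le> (\<Sum>i\<in>I. w i * X i x)} \<le> exp (- lam\<^sup>2 / 2)"
proof -
  \<comment> \<open>This \<open>s\<close> minimises the exponent
    \<open>s^2 * V / 2 - s * lam * sqrt V\<close>.\<close>
  define s where "s = lam / sqrt V"
  have s: "s > 0" using V lam by (simp add: s_def)
  have X [measurable]: "i \<in> I \<Longrightarrow> X i \<in> borel_measurable M" for i
    using indep by (auto simp: indep_vars_def)
  have "ennreal (prob {x\<in>space M. lam * sqrt V \<le> (\<Sum>i\<in>I. w i * X i x)})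
      = emeasure M {x\<in>space M. (\<Sum>i\<in>I. w i * X i x) \<ge> lam * sqrt V}"
    by (simp add: emeasure_eq_measure)
  also have "\<dots> \<le> ennreal (exp (-s * (lam * sqrt V))) *
      (\<integral>\<^sup>+x\<in>space M. exp (s * (\<Sum>i\<in>I. w i * X i x)) \<partial>M)"
    by (intro Chernoff_ineq_nn_integral_ge s) auto
  also have "(\<integral>\<^sup>+x\<in>space M. exp (s * (\<Sum>i\<in>I. w i * X i x)) \<partial>M) =
             (\<integral>\<^sup>+x. (\<Prod>i\<in>I. ennreal (exp (s * w i * X i x))) \<partial>M)"
    by (intro nn_integral_cong)
       (simp_all add: sum_distrib_left exp_sum fin prod_ennreal mult.assoc)
  also have "\<dots> = (\<Prod>i\<in>I. \<integral>\<^sup>+x. ennreal (exp (s * w i * X i x)) \<partial>M)"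
    by (intro indep_vars_nn_integral fin indep_vars_compose2[OF indep]) auto
  also have "\<dots> = (\<Prod>i\<in>I. ennreal (exp ((s * w i)\<^sup>2 / 2)))"
  proof (intro prod.cong refl)
    fix i assume "i \<in> I"
    show "(\<integral>\<^sup>+x. ennreal (exp (s * w i * X i x)) \<partial>M) = ennreal (exp ((s * w i)\<^sup>2 / 2))"
      using distributed_nn_integral[OF gauss[OF \<open>i \<in> I\<close>], of "\<lambda>x. ennreal (exp (s * w i * x))"]
      by (simp add: std_normal_mgf)
  qed
  also have "ennreal (exp (-s * (lam * sqrt V))) * \<dots> =
      ennreal (exp (-s * (lam * sqrt V)) * (\<Prod>i\<in>I. exp ((s * w i)\<^sup>2 / 2)))"
    by (simp add: prod_ennreal prod_nonneg flip: ennreal_mult)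
  also have "exp (-s * (lam * sqrt V)) * (\<Prod>i\<in>I. exp ((s * w i)\<^sup>2 / 2)) =
      exp (s\<^sup>2 * (\<Sum>i\<in>I. (w i)\<^sup>2) / 2 - s * (lam * sqrt V))"
    by (simp add: fin power_mult_distrib sum_distrib_left sum_divide_distrib exp_diff exp_minus
        field_simps flip: exp_sum)
  also have "\<dots> \<le> exp (s\<^sup>2 * V / 2 - s * (lam * sqrt V))"
    using V by (simp add: mult_left_mono)
  also have "s\<^sup>2 * V / 2 - s * (lam * sqrt V) = - lam\<^sup>2 / 2"
    using V by (simp add: s_def power_divide power2_eq_square)
  finally show ?thesis
    by (simp add: ennreal_leI)
qed

lemma gaussian_sum_tail:
  fixes X :: "'i \<Rightarrow> 'a \<Rightarrow> real"
  assumes fin: "finite I" and indep: "indep_vars (\<lambda>_. borel) X I"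
    and gauss: "\<And>i. i \<in> I \<Longrightarrow> distributed M lborel (X i) std_normal_density"
    and V: "0 < V" "(\<Sum>i\<in>I. (w i)\<^sup>2) \<le> V" and lam: "0 < lam"
  shows "prob {x\<in>space M. lam * sqrt V < \<bar>\<Sum>i\<in>I. w i * X i x\<bar>} \<le> 2 * exp (- lam\<^sup>2 / 2)"
proof -
  have X [measurable]: "i \<in> I \<Longrightarrow> X i \<in> borel_measurable M" for i
    using indep by (auto simp: indep_vars_def)
  let ?A = "\<lambda>w. {x\<in>space M. lam * sqrt V \<le> (\<Sum>i\<in>I. w i * X i x)}"
  have "prob {x\<in>space M. lam * sqrt V < \<bar>\<Sum>i\<in>I. w i * X i x\<bar>} \<le> prob (?A w \<union> ?A (\<lambda>i. - w i))"
    by (intro finite_measure_mono) (auto simp: sum_negf)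
  also have "\<dots> \<le> prob (?A w) + prob (?A (\<lambda>i. - w i))"
    by (intro measure_Un_le) auto
  also have "\<dots> \<le> exp (- lam\<^sup>2 / 2) + exp (- lam\<^sup>2 / 2)"
    using assms by (intro add_mono gaussian_sum_upper_tail) auto
  finally show ?thesis by simp
qed

lemma gaussian_increment_tail:
  assumes indep: "indep_vars (\<lambda>_. borel) X {1..n}"
    and gauss: "\<And>t. t \<in> {1..n} \<Longrightarrow> distributed M lborel (X t) std_normal_density"
    and uv: "0 \<le> u" "u < v" "v \<le> real n" and lam: "0 < lam"
  shows "prob {x\<in>space M. lam * sqrt (v - u) <
      \<bar>interp_sum (\<lambda>t. X t x) v - interp_sum (\<lambda>t. X t x) u\<bar>} \<le> 2 * exp (- lam\<^sup>2 / 2)"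
  using gaussian_sum_tail[of "{1..n}" X "v - u" "\<lambda>t. cell_part v t - cell_part u t" lam]
    sum_cell_part_diff_squared_le[of u v n] assms
  by (simp add: interp_sum_diff_eq_weighted[where n=n])

end

section \<open>Dyadic chaining\<close>

text \<open>The dyadic points \<open>d k\<close> just below \<open>u\<close> converge to
  \<open>u\<close>, and \<open>d k\<close>, \<open>d (Suc k)\<close> are equal or neighbours on the
  finer grid. Telescoping from level \<open>j\<close> on and continuity of \<open>B\<close> give the
  bound.\<close>

lemma dyadic_chaining:
  fixes B :: "real \<Rightarrow> real"
  assumes cont: "continuous_on {0..1} B"
    and step: "\<And>j i. i < 2 ^ j \<Longrightarrow> \<bar>B ((real i + 1) / 2 ^ j) - B (real i / 2 ^ j)\<bar> \<le> \<theta> j"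
    and summ: "summable \<theta>" and u: "u \<in> {0..1}"
  shows "\<bar>B u - B (real (nat \<lfloor>u * 2 ^ j\<rfloor>) / 2 ^ j)\<bar> \<le> (\<Sum>i. \<theta> (i + Suc j))"
proof -
  define N where "N k = nat \<lfloor>u * 2 ^ k\<rfloor>" for k
  define d where "d k = real (N k) / 2 ^ k" for k
  have N: "real (N k) \<le> u * 2 ^ k" "u * 2 ^ k < real (N k) + 1" for k
    using u by (auto simp: N_def)
  have \<theta>0: "0 \<le> \<theta> k" for k
    using step[of 0 k] by auto
  have d_le: "d k \<le> u" for k
    using N(1)[of k] by (simp add: d_def field_simps)
  have d_in: "d k \<in> {0..1}" for k
  proof -
    have "0 \<le> d k" by (simp add: d_def)
    then show ?thesis using u d_le[of k] by auto
  qed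
  have d_step: "\<bar>B (d (Suc k)) - B (d k)\<bar> \<le> \<theta> (Suc k)" for k
  proof -
    have "real (N (Suc k)) < 2 * real (N k) + 2" "2 * real (N k) < real (N (Suc k)) + 1"
      using N[of k] N[of "Suc k"] by auto
    \<comment> \<open>Doubling the resolution appends one binary digit.\<close>
    then have "N (Suc k) = 2 * N k \<or> N (Suc k) = 2 * N k + 1"
      by linarith
    then show ?thesis
    proof
      assume "N (Suc k) = 2 * N k"
      then show ?thesis using \<theta>0 by (simp add: d_def)
    next
      assume 1: "N (Suc k) = 2 * N k + 1"
      \<comment> \<open>Since \<open>u \<le> 1\<close>, the step to the right stays inside the unit
        interval; for \<open>u = 1\<close> this case does not occur.\<close>
      have "real (N (Suc k)) \<le> u * 2 ^ Suc k" by (rule N)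
      also have "\<dots> \<le> 1 * 2 ^ Suc k" using u by (intro mult_right_mono) auto
      finally have "real (N (Suc k)) \<le> real (2 ^ Suc k)" by simp
      then have "N (Suc k) \<le> 2 ^ Suc k" by (simp only: of_nat_le_iff)
      then have "2 * N k < 2 ^ Suc k" using 1 by linarith
      from step[OF this] show ?thesis
        using 1 by (simp add: d_def add.commute)
    qed
  qed
  have partial: "\<bar>B (d (m + j)) - B (d j)\<bar> \<le> (\<Sum>i<m. \<theta> (i + Suc j))" for m
  proof (induction m)
    case (Suc m)
    then show ?case using d_step[of "m + j"] by simp
  qed simp
  have summ': "summable (\<lambda>i. \<theta> (i + Suc j))"
    using summ by (subst summable_iff_shift)
  have bound: "\<bar>B (d (m + j)) - B (d j)\<bar> \<le> (\<Sum>i. \<theta> (i + Suc j))" for m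
    using partial[of m] sum_le_suminf[OF summ', of "{..<m}"] \<theta>0 by fastforce
  have "d \<longlonglongrightarrow> u"
  proof (rule real_tendsto_sandwich)
    show "\<forall>\<^sub>F k in sequentially. u - (1 / 2) ^ k \<le> d k"
    proof (intro always_eventually allI)
      fix k
      have "u \<le> (real (N k) + 1) / 2 ^ k"
        using N(2)[of k] by (simp add: pos_le_divide_eq)
      then show "u - (1 / 2) ^ k \<le> d k"
        by (simp add: d_def add_divide_distrib power_divide)
    qed
    show "\<forall>\<^sub>F k in sequentially. d k \<le> u"
      using d_le by simp
    show "(\<lambda>k. u - (1 / 2) ^ k) \<longlonglongrightarrow> u"
      using tendsto_diff[OF tendsto_const LIMSEQ_power_zero[of "1 / 2 :: real"], of u] by simp
  qed simp
  then have "(\<lambda>k. B (d k)) \<longlonglongrightarrow> B u"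
    using d_in u by (intro continuous_on_tendsto_compose[OF cont]) auto
  then have "(\<lambda>m. B (d (m + j))) \<longlonglongrightarrow> B u"
    by (rule LIMSEQ_ignore_initial_segment)
  then have "(\<lambda>m. \<bar>B (d (m + j)) - B (d j)\<bar>) \<longlonglongrightarrow> \<bar>B u - B (d j)\<bar>"
    by (intro tendsto_intros)
  then have "\<bar>B u - B (d j)\<bar> \<le> (\<Sum>i. \<theta> (i + Suc j))"
    using bound by (intro LIMSEQ_le_const2) auto
  then show ?thesis by (simp add: d_def N_def)
qed

section \<open>Control of increments on all dyadic grids\<close>

text \<open>The range of \<open>r\<close> suits both uses: an arbitrary interval is approximated by
  at most \<open>16 * (j + 1)\<close> cells of a suitable level \<open>j\<close>, and that level has
  at most \<open>2 ^ j * 16 * (j + 1)\<close> such grid intervals.\<close>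

definition dyadic_good :: "real \<Rightarrow> (real \<Rightarrow> real) \<Rightarrow> bool" where
  "dyadic_good C B \<longleftrightarrow>
     (\<forall>j i r. 1 \<le> r \<and> r \<le> 16 * (j + 1) \<and> i + r \<le> 2 ^ j \<longrightarrow>
        \<bar>B (real (i + r) / 2 ^ j) - B (real i / 2 ^ j)\<bar>
          \<le> (sqrt (2 * ln (exp 1 * 2 ^ j / real r)) + C) * sqrt (real r / 2 ^ j))"

text \<open>The \<open>m\<close>-th summand bounds the ratio of the chaining errors at levels
  \<open>j + 1 + m\<close> and \<open>j\<close>, uniformly in \<open>j\<close> and
  \<open>C\<close>.\<close>

definition chaining_const :: real where
  "chaining_const = (\<Sum>m. (real m + 2) * (1 / sqrt 2) ^ Suc m)"

lemma summable_if_bigo_inverse_square: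
  fixes f :: "nat \<Rightarrow> real"
  assumes "f \<in> O(\<lambda>n. 1 / real n ^ 2)"
  shows "summable f"
proof (rule summable_comparison_test_bigo[OF _ assms])
  show "summable (\<lambda>n. norm (1 / real n ^ 2))"
    using inverse_power_summable[of 2, where 'a = real] by (simp add: field_simps)
qed

lemma summable_chaining: "summable (\<lambda>m. (real m + 2) * (1 / sqrt 2) ^ Suc m)"
  by (intro summable_if_bigo_inverse_square) real_asymp

lemma chaining_const_nonneg: "0 \<le> chaining_const"
  unfolding chaining_const_def by (intro suminf_nonneg summable_chaining) simp

lemma sqrt_inverse_power2: "sqrt (1 / 2 ^ j) = (1 / sqrt 2) ^ j"
  by (simp add: real_sqrt_divide real_sqrt_power power_divide)

text \<open>Going \<open>i + 1\<close> levels down multiplies the bracket by at most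
  \<open>i + 2\<close>, because \<open>i + j + 2 \<le> (i + 2)^2 * (j + 1)\<close>, while the
  geometric factor shrinks. So the whole tail is comparable to the term at level
  \<open>j\<close>.\<close>

lemma summable_chaining_tail:
  assumes "0 \<le> C"
  defines "\<theta> \<equiv> \<lambda>j. (sqrt (2 * (real j + 1)) + C) * (1 / sqrt 2) ^ j"
  shows "summable \<theta>"
    and "(\<Sum>i. \<theta> (i + Suc j)) \<le> chaining_const * \<theta> j"
proof -
  show "summable \<theta>"
    unfolding \<theta>_def by (intro summable_if_bigo_inverse_square) real_asymp
  then have 1: "summable (\<lambda>i. \<theta> (i + Suc j))"
    by (subst summable_iff_shift)
  have 2: "\<theta> (i + Suc j) \<le> (real i + 2) * (1 / sqrt 2) ^ Suc i * \<theta> j" for i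
  proof -
    have "2 * (real (i + Suc j) + 1) \<le> (real i + 2)\<^sup>2 * (2 * (real j + 1))"
    proof -
      have "0 \<le> real i * real j" "0 \<le> real i * real i * real j" "0 \<le> real i * real i" by simp_all
      then show ?thesis unfolding power2_eq_square by (simp add: algebra_simps)
    qed
    then have "sqrt (2 * (real (i + Suc j) + 1)) \<le> (real i + 2) * sqrt (2 * (real j + 1))"
      by (metis (no_types) real_sqrt_le_mono real_sqrt_mult real_sqrt_abs abs_of_nonneg
          add_nonneg_nonneg of_nat_0_le_iff zero_le_numeral)
    moreover have "C \<le> (real i + 2) * C"
      using assms(1) by (simp add: algebra_simps)
    ultimately have "sqrt (2 * (real (i + Suc j) + 1)) + C
        \<le> (real i + 2) * (sqrt (2 * (real j + 1)) + C)"
      by (simp add: distrib_left)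
    then have "\<theta> (i + Suc j)
        \<le> (real i + 2) * (sqrt (2 * (real j + 1)) + C) * (1 / sqrt 2) ^ (i + Suc j)"
      unfolding \<theta>_def by (intro mult_right_mono) auto
    also have "\<dots> = (real i + 2) * (1 / sqrt 2) ^ Suc i * \<theta> j"
      by (simp add: \<theta>_def power_add)
    finally show ?thesis .
  qed
  have "(\<Sum>i. \<theta> (i + Suc j)) \<le> (\<Sum>i. (real i + 2) * (1 / sqrt 2) ^ Suc i * \<theta> j)"
    by (intro suminf_le 2 1 summable_mult2 summable_chaining)
  also have "\<dots> = chaining_const * \<theta> j"
    unfolding chaining_const_def by (intro suminf_mult2[symmetric] summable_chaining)
  finally show "(\<Sum>i. \<theta> (i + Suc j)) \<le> chaining_const * \<theta> j" .
qed

text \<open>The case \<open>r = 1\<close>, with \<open>ln (e * 2 ^ j) \<le> j + 1\<close> because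
  \<open>ln 2 \<le> 1\<close>.\<close>

lemma dyadic_good_step:
  assumes "dyadic_good C B" "i < 2 ^ j"
  shows "\<bar>B ((real i + 1) / 2 ^ j) - B (real i / 2 ^ j)\<bar>
    \<le> (sqrt (2 * (real j + 1)) + C) * (1 / sqrt 2) ^ j"
proof -
  have "\<bar>B (real (i + 1) / 2 ^ j) - B (real i / 2 ^ j)\<bar>
      \<le> (sqrt (2 * ln (exp 1 * 2 ^ j / real 1)) + C) * sqrt (real 1 / 2 ^ j)"
    using assms unfolding dyadic_good_def by (metis One_nat_def Suc_leI add.commute
        le_add1 le_add_same_cancel1 le_refl mult_le_mono nat_mult_1 one_le_numeral plus_1_eq_Suc)
  also have "sqrt (2 * ln (exp 1 * 2 ^ j / real 1)) \<le> sqrt (2 * (real j + 1))"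
    using ln_le_minus_one[of 2] by (simp add: ln_mult ln_realpow mult_left_le)
  finally show ?thesis
    by (simp add: sqrt_inverse_power2 mult_right_mono add.commute)
qed

lemma dyadic_good_modulus:
  assumes cont: "continuous_on {0..1} B" and good: "dyadic_good C B" and C: "0 \<le> C"
    and u: "u \<in> {0..1}"
  shows "\<bar>B u - B (real (nat \<lfloor>u * 2 ^ j\<rfloor>) / 2 ^ j)\<bar>
    \<le> chaining_const * ((sqrt (2 * (real j + 1)) + C) * (1 / sqrt 2) ^ j)"
  using dyadic_chaining[OF cont dyadic_good_step[OF good] summable_chaining_tail(1)[OF C] u, of j]
    summable_chaining_tail(2)[OF C, of j]
  by simp

lemma dyadic_scale:
  fixes x :: real
  assumes "0 < x" "x \<le> 1"
  obtains k where "(1 / 2) ^ Suc k < x" "x \<le> (1 / 2) ^ k"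
proof -
  define k where "k = (LEAST k. (1 / 2) ^ Suc k < x)"
  obtain m where "(1 / 2) ^ m < x"
    using real_arch_pow_inv[of x "1 / 2"] assms by auto
  then have "(1 / 2) ^ Suc m < x"
    by (rule le_less_trans[rotated]) (rule power_decreasing, auto)
  then have 1: "(1 / 2) ^ Suc k < x"
    unfolding k_def by (rule LeastI)
  have "x \<le> (1 / 2) ^ k"
  proof (cases k)
    case (Suc k')
    then show ?thesis
      using not_less_Least[of k' "\<lambda>k. (1 / 2) ^ Suc k < x"] by (simp add: k_def not_less)
  qed (use assms in simp)
  with 1 that show thesis by blast
qed

text \<open>
  An interval of length \<open>x\<close> between \<open>2 ^ - (k + 1)\<close> and \<open>2 ^ - k\<close> is approximated from inside
  on the grid of mesh \<open>2 ^ - (k + m)\<close>, where \<open>2 ^ m\<close> is of order \<open>k + 1\<close>: fine enough for the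
  modulus of continuity to contribute only \<open>O (sqrt x)\<close> at the two ends, coarse enough to have only
  polynomially many grid intervals per position.
\<close>

lemma dyadic_good_increment:
  assumes cont: "continuous_on {0..1} B" and good: "dyadic_good C B" and C: "0 \<le> C"
    and uv: "0 \<le> u" "u < v" "v \<le> 1"
  shows "\<bar>B v - B u\<bar> / sqrt (v - u)
    \<le> sqrt (2 * ln (exp 1 / (v - u))) + (2 * chaining_const + 2) * (C + 3)"
proof -
  define x where "x = v - u"
  have x: "0 < x" "x \<le> 1" using uv by (auto simp: x_def)
  obtain k where k: "(1 / 2) ^ Suc k < x" "x \<le> (1 / 2) ^ k"
    using dyadic_scale[OF x] .
  obtain p where p: "2 ^ p \<le> k + 1" "k + 1 < 2 ^ (p + 1)"
    using ex_power_ivl1[of 2 "k + 1"] by auto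
  \<comment> \<open>The shift by 4 puts \<open>M = 2 ^ m\<close> between \<open>8 * (k + 1)\<close>
    and \<open>16 * (k + 1)\<close>: the lower bound makes \<open>x\<close> span more than four
    cells, the upper bound keeps \<open>r\<close> in the range of
    \<open>dyadic_good\<close>.\<close>
  define m where "m = p + 4"
  define j where "j = k + m"
  define M where "M = (2 :: nat) ^ m"
  define N where "N = (2 :: real) ^ j"
  have M: "8 * (k + 1) < M" "M \<le> 16 * (k + 1)" "m \<le> M"
    using p less_exp[of m] by (auto simp: M_def m_def power_add)
  have N: "0 < N" "x * N \<le> real M" "real M < 2 * (x * N)"
    using k by (auto simp: N_def j_def M_def power_add power_divide field_simps)
  have "8 < M" using M(1) by simp
  then have M8: "8 < real M" by simp
  \<comment> \<open>The inner grid interval runs from \<open>iu + 1\<close>, the first grid point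
    right of \<open>u\<close>, to \<open>iv\<close>, the last one not beyond \<open>v\<close>. The
    modulus estimate refers to \<open>iu\<close> itself, so the left end costs one extra grid
    step.\<close>
  define iu where "iu = nat \<lfloor>u * N\<rfloor>"
  define iv where "iv = nat \<lfloor>v * N\<rfloor>"
  have iu: "real iu \<le> u * N" "u * N < real iu + 1"
    and iv: "real iv \<le> v * N" "v * N < real iv + 1"
    using uv N(1) by (auto simp: iu_def iv_def)
  have vu: "v * N - u * N = x * N" by (simp add: x_def algebra_simps)
  define r where "r = iv - (iu + 1)"
  have "real (iu + 1) < real iv"
    using iu iv vu N M8 by simp
  then have iur: "iu + 1 + r = iv" unfolding r_def by linarith
  then have r_eq: "real r = real iv - real iu - 1" by linarith
  \<comment> \<open>Rounding loses fewer than two cells, and \<open>x * N > 4\<close>.\<close>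
  have r: "x * N / 2 \<le> real r" "real r \<le> x * N"
    using r_eq iu iv vu N M8 by linarith+
  have r1: "1 \<le> r"
  proof -
    have "0 < real r" using r N M8 by linarith
    then show ?thesis by simp
  qed
  have "real r \<le> real (16 * (j + 1))"
  proof -
    have "real M \<le> real (16 * (j + 1))"
      using M(2) by (intro of_nat_mono) (simp add: j_def)
    then show ?thesis using r(2) N(2) by linarith
  qed
  then have r16: "r \<le> 16 * (j + 1)" by (simp only: of_nat_le_iff)
  have ivN: "iv \<le> 2 ^ j"
  proof -
    have "real iv \<le> 1 * N"
      using iv(1) uv N(1) mult_right_mono[of v 1 N] by linarith
    then have "real iv \<le> real (2 ^ j)" by (simp add: N_def)
    then show ?thesis by (simp only: of_nat_le_iff)
  qed
  define th where "th = (sqrt (2 * (real j + 1)) + C) * (1 / sqrt 2) ^ j"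
  have mid: "\<bar>B (real iv / N) - B (real (iu + 1) / N)\<bar>
      \<le> (sqrt (2 * ln (exp 1 * N / real r)) + C) * sqrt (real r / N)"
    using good r1 r16 ivN iur unfolding dyadic_good_def N_def by metis
  have eu: "\<bar>B u - B (real iu / N)\<bar> \<le> chaining_const * th"
    and ev: "\<bar>B v - B (real iv / N)\<bar> \<le> chaining_const * th"
    using dyadic_good_modulus[OF cont good C, of _ j] uv
    by (auto simp: th_def N_def iu_def iv_def)
  have e1: "\<bar>B (real (iu + 1) / N) - B (real iu / N)\<bar> \<le> th"
    using dyadic_good_step[OF good, of iu j] iur ivN r1 by (simp add: th_def N_def add.commute)
  have tri: "\<bar>B v - B u\<bar> \<le> (sqrt (2 * ln (exp 1 * N / real r)) + C) * sqrt (real r / N)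
      + (2 * chaining_const + 1) * th"
    using mid eu ev e1 by (simp add: algebra_simps) 
  \<comment> \<open>The mesh \<open>1 / N\<close> is at most \<open>2 * x / M\<close>, and
    \<open>M\<close> is large enough to offset the growth of the logarithm:
    \<open>4 * (j + 1) / M \<le> 8\<close>.\<close>
  have th: "th \<le> (3 + C) * sqrt x"
  proof -
    have "(1 / sqrt 2) ^ j = sqrt (1 / N)"
      by (simp add: N_def sqrt_inverse_power2)
    moreover have "1 / N \<le> x * (2 / real M)"
      using N M8 by (simp add: field_simps)
    ultimately have q: "(1 / sqrt 2) ^ j \<le> sqrt (2 / real M) * sqrt x"
      by (metis mult.commute real_sqrt_le_mono real_sqrt_mult)
    have "sqrt (2 * (real j + 1)) * sqrt (2 / real M) = sqrt (4 * (real j + 1) / real M)"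
      by (simp flip: real_sqrt_mult)
    also have "\<dots> \<le> sqrt (3\<^sup>2)"
    proof -
      have "real j + 1 \<le> 2 * real M"
        using M by (simp add: j_def)
      then show ?thesis using M8 by (intro real_sqrt_le_mono) (simp add: field_simps)
    qed
    finally have 1: "sqrt (2 * (real j + 1)) * sqrt (2 / real M) \<le> 3" by simp
    have 2: "C * sqrt (2 / real M) \<le> C"
      using C M8 by (intro mult_left_le) auto
    have "th \<le> (sqrt (2 * (real j + 1)) + C) * (sqrt (2 / real M) * sqrt x)"
      unfolding th_def using q C by (intro mult_left_mono) auto
    also have "\<dots> = (sqrt (2 * (real j + 1)) * sqrt (2 / real M) + C * sqrt (2 / real M)) * sqrt x"
      by (simp add: algebra_simps)
    also have "\<dots> \<le> (3 + C) * sqrt x"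
      using 1 2 x by (intro mult_right_mono add_mono) auto
    finally show ?thesis .
  qed
  have ln_x: "0 \<le> ln (exp 1 / x)"
    using x ln_le_minus_one[of x] by (simp add: ln_div)
  \<comment> \<open>The outer root uses \<open>r / N \<le> x\<close>. Inside the logarithm
    \<open>r / N \<ge> x / 2\<close> costs only \<open>ln 2\<close>, which the additive 2 absorbs by
    subadditivity of the root, leaving the leading constant unchanged.\<close>
  have main: "(sqrt (2 * ln (exp 1 * N / real r)) + C) * sqrt (real r / N)
      \<le> (sqrt (2 * ln (exp 1 / x)) + 2 + C) * sqrt x"
  proof -
    have rx: "real r / N \<le> x" "x / 2 \<le> real r / N"
      using r N by (auto simp: field_simps)
    have "ln (exp 1 * N / real r) \<le> ln (2 * (exp 1 / x))"
      using rx x r1 N(1) by (subst ln_le_cancel_iff) (auto simp: field_simps)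
    also have "\<dots> = ln 2 + ln (exp 1 / x)"
      using x by (simp add: ln_mult ln_div)
    finally have "2 * ln (exp 1 * N / real r) \<le> 2\<^sup>2 + 2 * ln (exp 1 / x)"
      using ln_le_minus_one[of 2] by simp
    then have "sqrt (2 * ln (exp 1 * N / real r)) \<le> sqrt (2\<^sup>2 + 2 * ln (exp 1 / x))"
      by (rule real_sqrt_le_mono)
    also have "\<dots> \<le> sqrt (2\<^sup>2) + sqrt (2 * ln (exp 1 / x))"
      using ln_x by (intro sqrt_add_le_add_sqrt) auto
    finally have "sqrt (2 * ln (exp 1 * N / real r)) + C \<le> sqrt (2 * ln (exp 1 / x)) + 2 + C"
      by simp
    moreover have "sqrt (real r / N) \<le> sqrt x" using rx by simp
    ultimately show ?thesis
      using x C ln_x N(1) by (intro mult_mono) auto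
  qed
  have th': "(2 * chaining_const + 1) * th \<le> (2 * chaining_const + 1) * ((3 + C) * sqrt x)"
    using th chaining_const_nonneg by (intro mult_left_mono) auto
  have "\<bar>B v - B u\<bar> \<le> (sqrt (2 * ln (exp 1 / x)) + 2 + C) * sqrt x
      + (2 * chaining_const + 1) * ((3 + C) * sqrt x)"
    using tri main th' by linarith
  also have "\<dots> \<le> (sqrt (2 * ln (exp 1 / x)) + (2 * chaining_const + 2) * (C + 3)) * sqrt x"
    using x by (simp add: algebra_simps)
  finally show ?thesis
    using x by (simp add: x_def field_simps)
qed

section \<open>Uniform tightness of the noise\<close>

text \<open>
  The factor \<open>256 * (j + 1)\<^sup>2\<close> counts grid intervals against the probability \<open>exp (- L)\<close> of each,
  and the exponential bounds the cross term of \<open>(sqrt (2 * L) + C)\<^sup>2 / 2\<close> for \<open>C \<ge> 1\<close>. For small \<open>j\<close>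
  the argument of the root may be negative, which is harmless since \<open>sqrt\<close> is odd and monotone.
\<close>

definition tail_weight :: "nat \<Rightarrow> real" where
  "tail_weight j =
    256 * (real j + 1)\<^sup>2 * exp (- sqrt (2 * (1 + real j * ln 2 - ln (16 * (real j + 1)))))"

lemma summable_tail_weight: "summable tail_weight"
  unfolding tail_weight_def by (intro summable_if_bigo_inverse_square) real_asymp

text \<open>The interpolated random walk in Donsker's scaling.\<close>

definition scaled_partial_sum :: "nat \<Rightarrow> (nat \<Rightarrow> real) \<Rightarrow> real \<Rightarrow> real" where
  "scaled_partial_sum n y x = interp_sum y (real n * x) / sqrt (real n)"

lemma continuous_on_scaled_partial_sum: "continuous_on {0..1} (scaled_partial_sum n y)"
proof -
  have "continuous_on {0..1} (interp_sum y \<circ> (\<lambda>x. real n * x))"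
    by (intro continuous_on_compose continuous_intros continuous_on_subset[OF continuous_on_interp_sum[of n]])
      (auto simp: mult_left_le)
  then show ?thesis
    unfolding scaled_partial_sum_def comp_def divide_inverse by (intro continuous_intros)
qed

text \<open>Expanding the square gives \<open>L + C^2 / 2 + C * sqrt (2 * L)\<close>. The factor
  \<open>exp (- L)\<close> is \<open>r / (e * 2 ^ j)\<close>, and the cross term is bounded by its
  value at \<open>C = 1\<close> and the largest \<open>r\<close>. The denominator on the right is
  there to cancel the number of intervals in the union bound.\<close>

lemma dyadic_tail_bound:
  assumes C: "1 \<le> C" and r: "1 \<le> r" "r \<le> 16 * (j + 1)" "r \<le> 2 ^ j"
  shows "2 * exp (- (sqrt (2 * ln (exp 1 * 2 ^ j / real r)) + C)\<^sup>2 / 2)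
    \<le> exp (- C\<^sup>2 / 2) * tail_weight j / (16 * (real j + 1) * 2 ^ j)"
proof -
  define L where "L = ln (exp 1 * 2 ^ j / real r)"
  define L' where "L' = 1 + real j * ln 2 - ln (16 * (real j + 1))"
  have rr: "1 \<le> real r" "real r \<le> 16 * (real j + 1)" "real r \<le> 2 ^ j"
  proof -
    have "real r \<le> real (2 ^ j)" using r(3) by (simp only: of_nat_le_iff)
    then show "real r \<le> 2 ^ j" by simp
    have "real r \<le> real (16 * (j + 1))" using r(2) by (simp only: of_nat_le_iff)
    then show "real r \<le> 16 * (real j + 1)" by simp
  qed (use r in simp)
  have L_eq: "L = 1 + real j * ln 2 - ln (real r)"
    using rr by (simp add: L_def ln_div ln_mult ln_realpow)
  have "ln (real r) \<le> ln (2 ^ j)" using rr by (subst ln_le_cancel_iff) auto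
  then have L1: "1 \<le> L" by (simp add: L_eq ln_realpow)
  have "ln (real r) \<le> ln (16 * (real j + 1))" using rr by (subst ln_le_cancel_iff) auto
  then have LL: "L' \<le> L" by (simp add: L_eq L'_def)
  have "(sqrt (2 * L) + C)\<^sup>2 / 2 = L + C\<^sup>2 / 2 + C * sqrt (2 * L)"
    using L1 by (simp add: power2_sum add_divide_distrib)
  moreover have "sqrt (2 * L') \<le> C * sqrt (2 * L)"
  proof -
    have "sqrt (2 * L') \<le> 1 * sqrt (2 * L)" using LL by simp
    also have "\<dots> \<le> C * sqrt (2 * L)" using C L1 by (intro mult_right_mono) auto
    finally show ?thesis .
  qed
  ultimately have "2 * exp (- (sqrt (2 * L) + C)\<^sup>2 / 2)
      \<le> 2 * exp (- L + - C\<^sup>2 / 2 + - sqrt (2 * L'))"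
    by simp
  also have "\<dots> = 2 * exp (- L) * (exp (- C\<^sup>2 / 2) * exp (- sqrt (2 * L')))"
    by (simp only: exp_add mult.assoc)
  also have "2 * exp (- L) \<le> 16 * (real j + 1) / 2 ^ j"
  proof -
    have "2 * exp (- L) = 2 * (real r / 2 ^ j) / exp 1"
      using rr by (simp add: L_def exp_minus)
    also have "\<dots> \<le> 2 * (real r / 2 ^ j) / 2"
      using exp_ge_add_one_self[of 1] by (intro divide_left_mono) auto
    also have "\<dots> \<le> 16 * (real j + 1) / 2 ^ j"
      using rr by (simp add: divide_right_mono)
    finally show ?thesis .
  qed
  also have "16 * (real j + 1) / 2 ^ j * (exp (- C\<^sup>2 / 2) * exp (- sqrt (2 * L')))
      = exp (- C\<^sup>2 / 2) * tail_weight j / (16 * (real j + 1) * 2 ^ j)"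
  proof -
    define A where "A = 16 * (real j + 1)"
    have "0 < A" by (simp add: A_def)
    moreover have "tail_weight j = A * A * exp (- sqrt (2 * L'))"
      unfolding tail_weight_def L'_def[symmetric] A_def by (simp add: power2_eq_square algebra_simps)
    ultimately show ?thesis
      unfolding A_def[symmetric] by simp
  qed
  finally show ?thesis
    by (simp add: L_def)
qed

lemma measurable_interp_sum:
  assumes "\<And>t. t \<in> {1..n} \<Longrightarrow> X t \<in> borel_measurable M" "0 \<le> x" "x \<le> real n"
  shows "(\<lambda>w. interp_sum (\<lambda>t. X t w) x) \<in> borel_measurable M"
  using assms by (simp add: interp_sum_eq_weighted[where n=n])

context prob_space
begin

text \<open>Union bound over the grid intervals of each level, then over the levels. Only countably
  many conditions are involved, hence measurability; the bound is free of \<open>n\<close>.\<close>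

lemma dyadic_good_complement:
  assumes n: "1 \<le> n" and indep: "indep_vars (\<lambda>_. borel) X {1..n}"
    and gauss: "\<And>t. t \<in> {1..n} \<Longrightarrow> distributed M lborel (X t) std_normal_density"
    and C: "1 \<le> C"
  defines "Bad \<equiv> {w \<in> space M. \<not> dyadic_good C (scaled_partial_sum n (\<lambda>t. X t w))}"
  shows "Bad \<in> events" and "prob Bad \<le> exp (- C\<^sup>2 / 2) * suminf tail_weight"
proof -
  have X: "t \<in> {1..n} \<Longrightarrow> X t \<in> borel_measurable M" for t
    using indep by (auto simp: indep_vars_def)
  define lam where "lam j r = sqrt (2 * ln (exp 1 * 2 ^ j / real r)) + C" for j r :: nat
  define E where "E j p = {w \<in> space M. lam j (snd p) * sqrt (real (snd p) / 2 ^ j) <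
      \<bar>scaled_partial_sum n (\<lambda>t. X t w) (real (fst p + snd p) / 2 ^ j) -
        scaled_partial_sum n (\<lambda>t. X t w) (real (fst p) / 2 ^ j)\<bar>}" for j p
  define I where "I j = {p. 1 \<le> snd p \<and> snd p \<le> 16 * (j + 1) \<and> fst p + snd p \<le> 2 ^ j}" for j :: nat
  define F where "F j = (\<Union>p\<in>I j. E j p)" for j
  have I_sub: "I j \<subseteq> {..<2 ^ j} \<times> {1..16 * (j + 1)}" for j
    by (auto simp: I_def)
  have I_fin: "finite (I j)" for j
    by (rule finite_subset[OF I_sub]) simp
  have I_card: "real (card (I j)) \<le> 2 ^ j * (16 * (real j + 1))" for j
  proof -
    have "card (I j) \<le> card ({..<2 ^ j :: nat} \<times> {1..16 * (j + 1)})"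
      by (rule card_mono[OF _ I_sub]) simp
    then have "real (card (I j)) \<le> real (2 ^ j * (16 * (j + 1)))"
      by (subst of_nat_le_iff) (simp add: card_cartesian_product)
    then show ?thesis by (simp add: algebra_simps)
  qed
  have Bad_eq: "Bad = (\<Union>j. F j)"
  proof (rule set_eqI)
    fix w
    have "w \<in> Bad \<longleftrightarrow> (\<exists>j i r. w \<in> space M \<and> 1 \<le> r \<and> r \<le> 16 * (j + 1) \<and> i + r \<le> 2 ^ j \<and>
        lam j r * sqrt (real r / 2 ^ j) <
        \<bar>scaled_partial_sum n (\<lambda>t. X t w) (real (i + r) / 2 ^ j) -
          scaled_partial_sum n (\<lambda>t. X t w) (real i / 2 ^ j)\<bar>)"
      unfolding Bad_def dyadic_good_def lam_def by (simp only: mem_Collect_eq not_le not_all not_imp) blast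
    also have "\<dots> \<longleftrightarrow> (\<exists>j i r. (i, r) \<in> I j \<and> w \<in> E j (i, r))"
      unfolding I_def E_def by (simp only: mem_Collect_eq fst_conv snd_conv) blast
    also have "\<dots> \<longleftrightarrow> w \<in> (\<Union>j. F j)"
      unfolding F_def by auto
    finally show "w \<in> Bad \<longleftrightarrow> w \<in> (\<Union>j. F j)" .
  qed
  have end_points: "0 \<le> real n * (real i / 2 ^ j)" "real n * (real i / 2 ^ j) \<le> real n"
    if "i \<le> 2 ^ j" for i j :: nat
  proof -
    have "real i \<le> real (2 ^ j)" using that by (simp only: of_nat_le_iff)
    then have "real i / 2 ^ j \<le> 1" by simp
    then show "real n * (real i / 2 ^ j) \<le> real n" by (intro mult_left_le) auto
  qed simp
  have E: "E j p \<in> events" "prob (E j p) \<le> exp (- C\<^sup>2 / 2) * tail_weight j / (16 * (real j + 1) * 2 ^ j)"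
    if "p \<in> I j" for j p
  proof -
    obtain i r where p: "p = (i, r)" by fastforce
    have r: "1 \<le> r" "r \<le> 16 * (j + 1)" "i + r \<le> 2 ^ j"
      using that by (auto simp: p I_def)
    define u where "u = real n * (real i / 2 ^ j)"
    define v where "v = real n * (real (i + r) / 2 ^ j)"
    have uv: "0 \<le> u" "u < v" "v \<le> real n"
      using end_points[of i j] end_points[of "i + r" j] r n
      by (auto simp: u_def v_def field_simps)
    have vu: "v - u = real n * (real r / 2 ^ j)"
      by (simp add: u_def v_def field_simps)
    have E_eq: "E j p = {w \<in> space M. lam j r * sqrt (v - u) <
        \<bar>interp_sum (\<lambda>t. X t w) v - interp_sum (\<lambda>t. X t w) u\<bar>}"
    proof -
      have "lam j r * sqrt (real r / 2 ^ j) < \<bar>a / sqrt (real n) - b / sqrt (real n)\<bar> \<longleftrightarrow>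
          lam j r * sqrt (v - u) < \<bar>a - b\<bar>" for a b
      proof -
        have "\<bar>a / sqrt (real n) - b / sqrt (real n)\<bar> = \<bar>a - b\<bar> / sqrt (real n)"
          by (simp flip: diff_divide_distrib)
        moreover have "sqrt (v - u) = sqrt (real n) * sqrt (real r / 2 ^ j)"
          by (simp only: vu real_sqrt_mult)
        moreover have "0 < sqrt (real n)" using n by simp
        ultimately show ?thesis
          by (simp only: pos_less_divide_eq) (simp only: mult.assoc mult.commute mult.left_commute)
      qed
      then show ?thesis
        by (simp only: E_def p scaled_partial_sum_def fst_conv snd_conv u_def v_def)
    qed
    have [measurable]: "(\<lambda>w. interp_sum (\<lambda>t. X t w) v) \<in> borel_measurable M"
      "(\<lambda>w. interp_sum (\<lambda>t. X t w) u) \<in> borel_measurable M"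
      using uv by (auto intro!: measurable_interp_sum[OF X])
    show "E j p \<in> events"
      unfolding E_eq by measurable
    have r2: "r \<le> 2 ^ j" using r by linarith
    \<comment> \<open>The tail bound needs a positive level; \<open>r \<le> 2 ^ j\<close> makes the
      logarithm nonnegative.\<close>
    have "0 < lam j r"
    proof -
      have "real r \<le> real (2 ^ j)" using r2 by (simp only: of_nat_le_iff)
      then have "1 \<le> exp 1 * (2 ^ j / real r)"
        using r(1) exp_ge_add_one_self[of 1] mult_mono[of 1 "exp 1" 1 "2 ^ j / real r"] by simp
      then show ?thesis using C by (simp add: lam_def add_nonneg_pos)
    qed
    then have "prob (E j p) \<le> 2 * exp (- (lam j r)\<^sup>2 / 2)"
      unfolding E_eq by (intro gaussian_increment_tail[OF indep gauss uv])
    also have "\<dots> \<le> exp (- C\<^sup>2 / 2) * tail_weight j / (16 * (real j + 1) * 2 ^ j)"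
      unfolding lam_def by (rule dyadic_tail_bound[OF C r(1,2) r2])
    finally show "prob (E j p) \<le> \<dots>" .
  qed
  have F_meas: "F j \<in> events" for j
    unfolding F_def using E(1) I_fin by (intro sets.finite_UN) auto
  then show "Bad \<in> events"
    unfolding Bad_eq by auto
  have F: "prob (F j) \<le> exp (- C\<^sup>2 / 2) * tail_weight j" for j
  proof -
    have "prob (F j) \<le> (\<Sum>p\<in>I j. prob (E j p))"
      unfolding F_def using E(1) I_fin by (intro finite_measure_subadditive_finite) auto
    also have "\<dots> \<le> real (card (I j)) *
        (exp (- C\<^sup>2 / 2) * tail_weight j / (16 * (real j + 1) * 2 ^ j))"
      using E(2) by (intro sum_bounded_above) auto
    also have "\<dots> \<le> (2 ^ j * (16 * (real j + 1))) *
        (exp (- C\<^sup>2 / 2) * tail_weight j / (16 * (real j + 1) * 2 ^ j))"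
      using I_card by (intro mult_right_mono) (auto simp: tail_weight_def)
    also have "\<dots> = exp (- C\<^sup>2 / 2) * tail_weight j"
      by simp
    finally show ?thesis .
  qed
  have summ: "summable (\<lambda>j. exp (- C\<^sup>2 / 2) * tail_weight j)"
    by (intro summable_mult summable_tail_weight)
  have summ': "summable (\<lambda>j. prob (F j))"
    using F by (intro summable_comparison_test'[OF summ, of 0]) auto
  have "prob Bad \<le> (\<Sum>j. prob (F j))"
    unfolding Bad_eq using F_meas summ' by (intro finite_measure_subadditive_countably) auto
  also have "\<dots> \<le> (\<Sum>j. exp (- C\<^sup>2 / 2) * tail_weight j)"
    by (intro suminf_le F summ summ')
  also have "\<dots> = exp (- C\<^sup>2 / 2) * suminf tail_weight"
    by (intro suminf_mult summable_tail_weight)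
  finally show "prob Bad \<le> exp (- C\<^sup>2 / 2) * suminf tail_weight" .
qed

end

section \<open>The scan statistic\<close>

text \<open>For \<open>h > 0\<close> the statistic becomes the supremum of a continuous function
  over a compact set of pairs, which gives finiteness and measurability.\<close>

definition scan_index :: "nat \<Rightarrow> real \<Rightarrow> (real \<times> real) set" where
  "scan_index n h = {p. 0 \<le> fst p \<and> fst p < snd p \<and> snd p \<le> real n \<and> h \<le> snd p - fst p}"

definition scan_term :: "nat \<Rightarrow> (nat \<Rightarrow> real) \<Rightarrow> real \<times> real \<Rightarrow> real" where
  "scan_term n y p =
     max (local_stat y (fst p) (snd p) - sqrt (2 * ln (exp 1 * real n / (snd p - fst p)))) 0"

lemma DS_stat_eq_scan: "DS_stat 1 n h y = (SUP p\<in>scan_index n h. scan_term n y p)"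
  by (simp add: DS_stat_def scan_index_def scan_term_def case_prod_unfold)

text \<open>The strict inequality between the endpoints follows from the closed condition on the
  length, since \<open>h > 0\<close>.\<close>

lemma compact_scan_index:
  assumes "0 < h"
  shows "compact (scan_index n h)"
proof -
  have "scan_index n h = ({0..real n} \<times> {0..real n}) \<inter> {p. h \<le> snd p - fst p}"
    using assms by (auto simp: scan_index_def)
  moreover have "closed {p :: real \<times> real. h \<le> snd p - fst p}"
    by (intro closed_Collect_le continuous_intros)
  ultimately show ?thesis
    by (simp add: compact_Int_closed compact_Times)
qed

lemma scan_index_nonempty:
  assumes "0 < h" "h \<le> real n"
  shows "scan_index n h \<noteq> {}"
proof -
  have "(0, real n) \<in> scan_index n h" using assms by (simp add: scan_index_def)
  then show ?thesis by blast
qed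

lemma continuous_on_scan_term: "continuous_on (scan_index n h) (scan_term n y)"
proof -
  have 1: "continuous_on (scan_index n h) (\<lambda>p. interp_sum y (fst p))"
    "continuous_on (scan_index n h) (\<lambda>p. interp_sum y (snd p))"
    by (intro continuous_on_compose2[OF continuous_on_interp_sum[of n]] continuous_intros;
        auto simp: scan_index_def)+
  have 2: "snd p - fst p \<noteq> 0" "exp 1 * real n / (snd p - fst p) \<noteq> 0" if "p \<in> scan_index n h" for p
    using that by (auto simp: scan_index_def)
  show ?thesis
    unfolding scan_term_def local_stat_def
    by (intro continuous_intros 1 ballI) (use 2 in auto)
qed

lemma bdd_above_scan_term:
  assumes "0 < h"
  shows "bdd_above (scan_term n y ` scan_index n h)"
  by (intro bounded_imp_bdd_above compact_imp_bounded compact_continuous_image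
      continuous_on_scan_term compact_scan_index assms)

lemma DS_stat_ge:
  assumes "0 < h" "0 \<le> u" "v \<le> real n" "h \<le> v - u"
  shows "local_stat y u v - sqrt (2 * ln (exp 1 * real n / (v - u))) \<le> DS_stat 1 n h y"
proof -
  have "(u, v) \<in> scan_index n h" using assms by (simp add: scan_index_def)
  then have "scan_term n y (u, v) \<le> DS_stat 1 n h y"
    unfolding DS_stat_eq_scan by (intro cSUP_upper bdd_above_scan_term assms)
  then show ?thesis by (simp add: scan_term_def)
qed

lemma DS_stat_le:
  assumes "0 < h" "h \<le> real n" "0 \<le> K"
    and "\<And>u v. 0 \<le> u \<Longrightarrow> u < v \<Longrightarrow> v \<le> real n \<Longrightarrow> h \<le> v - u \<Longrightarrow>
      local_stat y u v \<le> sqrt (2 * ln (exp 1 * real n / (v - u))) + K"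
  shows "DS_stat 1 n h y \<le> K"
  unfolding DS_stat_eq_scan
proof (rule cSUP_least[OF scan_index_nonempty[OF assms(1,2)]])
  fix p assume "p \<in> scan_index n h"
  then show "scan_term n y p \<le> K"
    using assms(3) assms(4)[of "fst p" "snd p"] by (auto simp: scan_index_def scan_term_def)
qed

lemma DS_stat_nonneg:
  assumes "0 < h" "h \<le> real n"
  shows "0 \<le> DS_stat 1 n h y"
proof -
  obtain p where p: "p \<in> scan_index n h" using scan_index_nonempty[OF assms] by blast
  have "0 \<le> scan_term n y p" by (simp add: scan_term_def)
  also have "\<dots> \<le> DS_stat 1 n h y"
    unfolding DS_stat_eq_scan by (intro cSUP_upper bdd_above_scan_term p assms)
  finally show ?thesis .
qed

text \<open>By continuity the supremum over all real endpoints equals that over a countable dense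
  subset.\<close>

lemma measurable_DS_stat:
  assumes X: "\<And>t. t \<in> {1..n} \<Longrightarrow> X t \<in> borel_measurable M" and h: "0 < h" "h \<le> real n"
  shows "(\<lambda>w. DS_stat 1 n h (\<lambda>t. X t w)) \<in> borel_measurable M"
proof -
  obtain D where D: "countable D" "D \<subseteq> scan_index n h" "scan_index n h \<subseteq> closure D"
    using separable by blast
  have D_ne: "D \<noteq> {}" using D(3) scan_index_nonempty[OF h] by auto
  have clos: "closure D = scan_index n h"
    using D closure_minimal[OF D(2) compact_imp_closed[OF compact_scan_index[OF h(1)]]] by blast
  have bdd: "bdd_above (scan_term n y ` D)" for y
    using bdd_above_scan_term[OF h(1)] D(2) by (meson bdd_above_mono image_mono)
  have "DS_stat 1 n h y = (SUP p\<in>D. scan_term n y p)" for y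
    unfolding DS_stat_eq_scan
  proof (rule antisym)
    show "(SUP p\<in>scan_index n h. scan_term n y p) \<le> (SUP p\<in>D. scan_term n y p)"
    proof (rule cSUP_least[OF scan_index_nonempty[OF h]])
      fix p assume "p \<in> scan_index n h"
      then show "scan_term n y p \<le> (SUP p\<in>D. scan_term n y p)"
        using continuous_on_scan_term[of n h y]
        by (intro continuous_le_on_closure[of D "scan_term n y" p])
          (auto simp: clos intro!: cSUP_upper bdd)
    qed
    show "(SUP p\<in>D. scan_term n y p) \<le> (SUP p\<in>scan_index n h. scan_term n y p)"
      by (intro cSUP_subset_mono D_ne bdd_above_scan_term h D) auto
  qed
  moreover have "(\<lambda>w. SUP p\<in>D. scan_term n (\<lambda>t. X t w) p) \<in> borel_measurable M"
  proof (intro borel_measurable_cSUP D bdd)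
    fix p assume "p \<in> D"
    then have "0 \<le> fst p" "snd p \<le> real n" "fst p < snd p"
      using D(2) by (auto simp: scan_index_def)
    then have [measurable]: "(\<lambda>w. interp_sum (\<lambda>t. X t w) (fst p)) \<in> borel_measurable M"
      "(\<lambda>w. interp_sum (\<lambda>t. X t w) (snd p)) \<in> borel_measurable M"
      by (auto intro!: measurable_interp_sum[OF X])
    show "(\<lambda>w. scan_term n (\<lambda>t. X t w) p) \<in> borel_measurable M"
      unfolding scan_term_def local_stat_def by measurable
  qed
  ultimately show ?thesis by simp
qed

section \<open>Bounds on the statistic by signal and noise\<close>

text \<open>The local statistic is invariant under the rescaling to [0, 1], and the penalty depends
  only on the relative length \<open>(v - u) / n\<close>.\<close>

lemma dyadic_good_local_stat:
  assumes n: "1 \<le> n" and good: "dyadic_good C (scaled_partial_sum n e)" and C: "0 \<le> C"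
    and uv: "0 \<le> u" "u < v" "v \<le> real n"
  shows "local_stat e u v
    \<le> sqrt (2 * ln (exp 1 * real n / (v - u))) + (2 * chaining_const + 2) * (C + 3)"
proof -
  have n0: "0 < real n" using n by simp
  have "\<bar>scaled_partial_sum n e (v / real n) - scaled_partial_sum n e (u / real n)\<bar> /
      sqrt (v / real n - u / real n) = local_stat e u v"
  proof -
    have "\<bar>scaled_partial_sum n e (v / real n) - scaled_partial_sum n e (u / real n)\<bar> =
        \<bar>interp_sum e v - interp_sum e u\<bar> / sqrt (real n)"
      using n0 by (simp add: scaled_partial_sum_def flip: diff_divide_distrib)
    moreover have "sqrt (v / real n - u / real n) = sqrt (v - u) / sqrt (real n)"
      by (simp add: real_sqrt_divide flip: diff_divide_distrib)
    ultimately show ?thesis using n0 by (simp add: local_stat_def)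
  qed
  moreover have "exp 1 / (v / real n - u / real n) = exp 1 * real n / (v - u)"
    by (simp flip: diff_divide_distrib)
  ultimately show ?thesis
    using dyadic_good_increment[OF continuous_on_scaled_partial_sum good C, of "u / real n" "v / real n"]
      uv n0 by (simp add: divide_strict_right_mono)
qed

lemma DS_stat_upper_bound:
  assumes n: "1 \<le> n" and good: "dyadic_good C (scaled_partial_sum n e)" and C: "0 \<le> C"
    and h: "0 < h" "h \<le> real n" and ab: "a \<le> b" "b \<le> n"
  shows "DS_stat 1 n h (\<lambda>t. m * indicator {a<..b} t + e t)
    \<le> (2 * chaining_const + 2) * (C + 3) + \<bar>m\<bar> * (real b - real a) / sqrt h"
proof (rule DS_stat_le[OF h])
  show "0 \<le> (2 * chaining_const + 2) * (C + 3) + \<bar>m\<bar> * (real b - real a) / sqrt h"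
    using chaining_const_nonneg C h ab by (intro add_nonneg_nonneg mult_nonneg_nonneg divide_nonneg_nonneg) auto
next
  fix u v assume uv: "0 \<le> u" "u < v" "v \<le> real n" "h \<le> v - u"
  define W where "W = (\<Sum>t=1..n. (cell_part v t - cell_part u t) * indicator {a<..b} t :: real)"
  have W: "0 \<le> W" "W \<le> real b - real a"
    unfolding W_def using signal_weight_bounds[of u v a b n] uv ab by auto
  have uv': "u \<le> v" using uv by simp
  have "local_stat (\<lambda>t. m * indicator {a<..b} t + e t) u v =
      \<bar>m * W + (interp_sum e v - interp_sum e u)\<bar> / sqrt (v - u)"
    unfolding local_stat_def interp_sum_diff_signal[OF uv(1) uv' uv(3)] W_def ..
  also have "\<dots> \<le> (\<bar>m * W\<bar> + \<bar>interp_sum e v - interp_sum e u\<bar>) / sqrt (v - u)"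
    using uv by (intro divide_right_mono abs_triangle_ineq) auto
  also have "\<dots> = \<bar>m\<bar> * W / sqrt (v - u) + local_stat e u v"
    using W by (simp add: local_stat_def add_divide_distrib abs_mult)
  also have "\<bar>m\<bar> * W / sqrt (v - u) \<le> \<bar>m\<bar> * (real b - real a) / sqrt h"
    using W uv h ab by (intro frac_le mult_left_mono mult_nonneg_nonneg) auto
  also note dyadic_good_local_stat[OF n good C uv(1-3)]
  finally show "local_stat (\<lambda>t. m * indicator {a<..b} t + e t) u v
      \<le> sqrt (2 * ln (exp 1 * real n / (v - u))) +
        ((2 * chaining_const + 2) * (C + 3) + \<bar>m\<bar> * (real b - real a) / sqrt h)"
    by simp
qed

text \<open>The window of length \<open>h\<close> starts at \<open>a\<close>, or is shifted left to
  end at \<open>n\<close> if it would stick out; in both cases it contains all of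
  \<open>(a, b]\<close>.\<close>

lemma DS_stat_lower_bound:
  assumes h: "0 < h" "h \<le> real n" and ab: "a \<le> b" "b \<le> n" "real b - real a \<le> h"
  defines "u \<equiv> min (real a) (real n - h)"
  shows "\<bar>m\<bar> * (real b - real a) / sqrt h - \<bar>interp_sum e (u + h) - interp_sum e u\<bar> / sqrt h
      - sqrt (2 * ln (exp 1 * real n / h))
    \<le> DS_stat 1 n h (\<lambda>t. m * indicator {a<..b} t + e t)"
proof -
  have "real b \<le> real n" using ab by simp
  then have u: "0 \<le> u" "u \<le> u + h" "u + h \<le> real n" "u \<le> real a" "real b \<le> u + h"
    using h ab by (auto simp: u_def min_def)
  have "local_stat (\<lambda>t. m * indicator {a<..b} t + e t) u (u + h) =
      \<bar>m * (real b - real a) + (interp_sum e (u + h) - interp_sum e u)\<bar> / sqrt h"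
    unfolding local_stat_def interp_sum_diff_signal[OF u(1-3)] signal_weight_full[OF u(4,5) ab(1,2)]
    by simp
  moreover have "\<bar>m\<bar> * (real b - real a) / sqrt h - \<bar>interp_sum e (u + h) - interp_sum e u\<bar> / sqrt h
      \<le> \<bar>m * (real b - real a) + (interp_sum e (u + h) - interp_sum e u)\<bar> / sqrt h"
  proof -
    have "\<bar>m\<bar> * (real b - real a) = \<bar>m * (real b - real a)\<bar>"
      using ab by (simp add: abs_mult)
    then have "\<bar>m\<bar> * (real b - real a) - \<bar>interp_sum e (u + h) - interp_sum e u\<bar>
        \<le> \<bar>m * (real b - real a) + (interp_sum e (u + h) - interp_sum e u)\<bar>"
      by linarith
    then show ?thesis
      using h by (simp add: divide_right_mono flip: diff_divide_distrib)
  qed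
  ultimately show ?thesis
    using DS_stat_ge[of h u "u + h" n "\<lambda>t. m * indicator {a<..b} t + e t"] h u by simp
qed

theorem proposition1p2:
  fixes M :: "nat \<Rightarrow> 'a measure"
    and \<eta> :: "nat \<Rightarrow> nat \<Rightarrow> 'a \<Rightarrow> real"
    and a b :: "nat \<Rightarrow> nat"
    and \<mu> h :: "nat \<Rightarrow> real"
  defines "l \<equiv> \<lambda>n. real (b n) - real (a n)"
    and "Y \<equiv> \<lambda>n t \<omega>. \<mu> n * indicator {a n<..b n} t + \<eta> n t \<omega>"
  defines "T \<equiv> \<lambda>n \<omega>. DS_stat 1 n (h n) (\<lambda>t. Y n t \<omega>)"
  assumes prob: "\<And>n. n \<ge> 1 \<Longrightarrow> prob_space (M n)"
    and gauss: "\<And>n t. n \<ge> 1 \<Longrightarrow> t \<in> {1..n} \<Longrightarrow>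
                  distributed (M n) lborel (\<eta> n t) std_normal_density"
    and indep: "\<And>n. n \<ge> 1 \<Longrightarrow>
                  prob_space.indep_vars (M n) (\<lambda>_. borel) (\<eta> n) {1..n}"
    and ab: "\<And>n. n \<ge> 1 \<Longrightarrow> a n < b n \<and> b n \<le> n"
    and h: "\<And>n. n \<ge> 1 \<Longrightarrow> 0 < h n \<and> h n \<le> real n \<and> l n \<le> h n"
  shows "(much_larger (\<lambda>n. (\<mu> n)\<^sup>2 * l n * (l n / h n)) (\<lambda>n. ln (exp 1 * real n / h n)) \<longrightarrow>
            tends_to_infinity_in_prob M T \<and> consistent_test M T) \<and>
         ((\<lambda>n. (\<mu> n)\<^sup>2 * l n * (l n / h n)) \<in> O(\<lambda>_. 1) \<longrightarrow>
            bounded_in_prob M T \<and> \<not> consistent_test M T)"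
proof -
  have l: "0 < l n" "l n \<le> h n" "0 < h n" "h n \<le> real n" "a n \<le> b n" "b n \<le> n" if "1 \<le> n" for n
    using ab[OF that] h[OF that] by (auto simp: l_def)
  \<comment> \<open>The drift of the statistic is the root of the quantity in both
    hypotheses.\<close>
  have signal: "\<bar>\<mu> n\<bar> * l n / sqrt (h n) = sqrt ((\<mu> n)\<^sup>2 * l n * (l n / h n))" if "1 \<le> n" for n
  proof -
    have "(\<mu> n)\<^sup>2 * l n * (l n / h n) = (\<bar>\<mu> n\<bar> * l n)\<^sup>2 / h n"
      by (simp add: power2_eq_square)
    then show ?thesis
      using l[OF that] by (simp add: real_sqrt_divide)
  qed
  have \<eta>_meas: "\<eta> n t \<in> borel_measurable (M n)" if "1 \<le> n" "t \<in> {1..n}" for n t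
    using gauss[OF that] by (simp add: distributed_def)
  have T_meas: "T n \<in> borel_measurable (M n)" if n: "1 \<le> n" for n
    unfolding T_def Y_def
    using \<eta>_meas[OF n] l[OF n] by (intro measurable_DS_stat) auto
  then have T_meas_ev: "\<forall>\<^sub>F n in sequentially. T n \<in> borel_measurable (M n)"
    by (intro eventually_sequentiallyI[of 1])
  have T_nonneg: "0 \<le> T n w" if "1 \<le> n" for n w
    unfolding T_def using l[OF that] by (intro DS_stat_nonneg)

  have part_i: "(\<lambda>n. \<P>(w in M n. T n w > c)) \<longlonglongrightarrow> 1"
    if large: "much_larger (\<lambda>n. (\<mu> n)\<^sup>2 * l n * (l n / h n)) (\<lambda>n. ln (exp 1 * real n / h n))" for c
  proof (rule tendstoI)
    fix \<epsilon> :: real assume "0 < \<epsilon>"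
    have "((\<lambda>x :: real. 2 * exp (- x\<^sup>2 / 2)) \<longlongrightarrow> 0) at_top" by real_asymp
    then have "\<forall>\<^sub>F x :: real in at_top. 2 * exp (- x\<^sup>2 / 2) < \<epsilon> \<and> 0 < x"
      using \<open>0 < \<epsilon>\<close> by (intro eventually_conj order_tendstoD eventually_gt_at_top) auto
    then obtain lam :: real where lam: "2 * exp (- lam\<^sup>2 / 2) < \<epsilon>" "0 < lam"
      using eventually_happens'[OF trivial_limit_at_top_linorder] by blast
    \<comment> \<open>Here \<open>lam\<close> pays for the noise and
      \<open>\<bar>c\<bar> + 1\<close> lifts the statistic strictly above \<open>c\<close>.\<close>
    define K where "K = \<bar>c\<bar> + lam + 1"
    have K: "0 < K" using lam by (simp add: K_def)
    \<comment> \<open>This yields \<open>(K + 2) * sqrt L \<le> sqrt x\<close>: as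
      \<open>L \<ge> 1\<close>, the part \<open>K * sqrt L\<close> covers \<open>K\<close>, and
      \<open>2 * sqrt L\<close> covers the penalty \<open>sqrt (2 * L)\<close>.\<close>
    have "\<forall>\<^sub>F n in sequentially. ln (exp 1 * real n / h n) / ((\<mu> n)\<^sup>2 * l n * (l n / h n)) < 1 / (K + 2)\<^sup>2"
      using large K unfolding much_larger_def by (intro order_tendstoD(2)) auto
    moreover have "\<forall>\<^sub>F n in sequentially. 0 < (\<mu> n)\<^sup>2 * l n * (l n / h n)"
      using large unfolding much_larger_def by (auto elim: eventually_mono)
    moreover have "\<forall>\<^sub>F n in sequentially. 1 \<le> n" by (rule eventually_ge_at_top)
    ultimately show "\<forall>\<^sub>F n in sequentially. dist (\<P>(w in M n. T n w > c)) 1 < \<epsilon>"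
    proof eventually_elim
      case (elim n)
      interpret prob_space "M n" by (rule prob) fact
      note ln = l[OF elim(3)]
      define L where "L = ln (exp 1 * real n / h n)"
      define x where "x = (\<mu> n)\<^sup>2 * l n * (l n / h n)"
      have x: "0 < x" "L / x < 1 / (K + 2)\<^sup>2" using elim by (simp_all add: x_def L_def)
      have L1: "1 \<le> L"
      proof -
        have "0 \<le> ln (real n / h n)" using ln by simp
        moreover have "L = 1 + ln (real n / h n)"
          using ln elim(3) ln_mult[of "exp 1" "real n / h n"] by (simp add: L_def)
        ultimately show ?thesis by simp
      qed
      have sqrt_x: "K + sqrt (2 * L) \<le> sqrt x"
      proof -
        have "(K + 2)\<^sup>2 * L \<le> x"
          using x K by (simp add: field_simps)
        then have "sqrt ((K + 2)\<^sup>2 * L) \<le> sqrt x" by (rule real_sqrt_le_mono)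
        then have 1: "(K + 2) * sqrt L \<le> sqrt x" using K by (simp add: real_sqrt_mult)
        have "K * 1 \<le> K * sqrt L" using K L1 by (intro mult_left_mono) auto
        moreover have "sqrt (2 * L) \<le> 2 * sqrt L"
          using L1 sqrt2_less_2 by (simp add: real_sqrt_mult mult_right_mono)
        ultimately show ?thesis using 1 by (simp add: distrib_right)
      qed
      define u where "u = min (real (a n)) (real n - h n)"
      define inc where "inc w = interp_sum (\<lambda>t. \<eta> n t w) (u + h n) - interp_sum (\<lambda>t. \<eta> n t w) u" for w
      have u: "0 \<le> u" "u < u + h n" "u + h n \<le> real n"
        using ln by (auto simp: u_def)
      have tail: "prob {w \<in> space (M n). lam * sqrt (h n) < \<bar>inc w\<bar>} \<le> 2 * exp (- lam\<^sup>2 / 2)"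
        using gaussian_increment_tail[OF indep[OF elim(3)] gauss[OF elim(3)] u lam(2)]
        by (simp add: inc_def)
      have T_gt: "c < T n w" if "\<bar>inc w\<bar> \<le> lam * sqrt (h n)" for w
      proof -
        have "sqrt x - \<bar>inc w\<bar> / sqrt (h n) - sqrt (2 * L) \<le> T n w"
          using DS_stat_lower_bound[of "h n" n "a n" "b n" "\<mu> n" "\<lambda>t. \<eta> n t w"] ln signal[OF elim(3)]
          by (simp add: T_def Y_def u_def inc_def L_def x_def l_def)
        moreover have "\<bar>inc w\<bar> / sqrt (h n) \<le> lam"
          using that ln by (simp add: pos_divide_le_eq)
        ultimately show ?thesis using sqrt_x by (simp add: K_def)
      qed
      have [measurable]: "T n \<in> borel_measurable (M n)" by (rule T_meas) fact
      have [measurable]: "inc \<in> borel_measurable (M n)"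
        unfolding inc_def using u \<eta>_meas[OF elim(3)]
        by (intro borel_measurable_diff measurable_interp_sum[of n]) auto
      have "1 - prob {w \<in> space (M n). T n w > c} = prob {w \<in> space (M n). \<not> T n w > c}"
        by (subst prob_neg) auto
      also have "\<dots> \<le> prob {w \<in> space (M n). lam * sqrt (h n) < \<bar>inc w\<bar>}"
        using T_gt by (intro finite_measure_mono) (auto simp: not_less[symmetric])
      finally have "1 - prob {w \<in> space (M n). T n w > c} < \<epsilon>"
        using tail lam by linarith
      then show ?case
        using prob_le_1[of "{w \<in> space (M n). T n w > c}"] by (simp add: dist_real_def)
    qed
  qed

  have part_ii: "bounded_in_prob M T"
    if bigo: "(\<lambda>n. (\<mu> n)\<^sup>2 * l n * (l n / h n)) \<in> O(\<lambda>_. 1)"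
    unfolding bounded_in_prob_def
  proof (intro conjI T_meas_ev allI impI)
    fix \<epsilon> :: real assume "0 < \<epsilon>"
    obtain c where c: "\<forall>\<^sub>F n in sequentially. norm ((\<mu> n)\<^sup>2 * l n * (l n / h n)) \<le> c * norm (1 :: real)"
      using bigo by (elim landau_o.bigE)
    have "((\<lambda>x :: real. exp (- x\<^sup>2 / 2)) \<longlongrightarrow> 0) at_top" by real_asymp
    then have "((\<lambda>x :: real. exp (- x\<^sup>2 / 2) * suminf tail_weight) \<longlongrightarrow> 0) at_top"
      by (rule tendsto_mult_left_zero)
    then have "\<forall>\<^sub>F x :: real in at_top. exp (- x\<^sup>2 / 2) * suminf tail_weight < \<epsilon> \<and> 1 \<le> x"
      using \<open>0 < \<epsilon>\<close> by (intro eventually_conj order_tendstoD eventually_ge_at_top) auto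
    then obtain C :: real where C: "exp (- C\<^sup>2 / 2) * suminf tail_weight < \<epsilon>" "1 \<le> C"
      using eventually_happens'[OF trivial_limit_at_top_linorder] by blast
    \<comment> \<open>The first term bounds the penalised noise on the good event, the second the
      drift.\<close>
    define K where "K = (2 * chaining_const + 2) * (C + 3) + sqrt c"
    have "\<forall>\<^sub>F n in sequentially. \<P>(w in M n. \<bar>T n w\<bar> > K) \<le> \<epsilon>"
      using c eventually_ge_at_top[of 1]
    proof eventually_elim
      case (elim n)
      interpret prob_space "M n" by (rule prob) fact
      note ln = l[OF elim(2)]
      let ?Bad = "{w \<in> space (M n). \<not> dyadic_good C (scaled_partial_sum n (\<lambda>t. \<eta> n t w))}"
      note bad = dyadic_good_complement[OF elim(2) indep[OF elim(2)] gauss[OF elim(2)] C(2)]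
      have "\<bar>T n w\<bar> \<le> K" if "dyadic_good C (scaled_partial_sum n (\<lambda>t. \<eta> n t w))" for w
      proof -
        have "sqrt ((\<mu> n)\<^sup>2 * l n * (l n / h n)) \<le> sqrt c"
        proof (rule real_sqrt_le_mono)
          have "\<bar>(\<mu> n)\<^sup>2 * l n * (l n / h n)\<bar> \<le> c"
            using elim(1) by (simp only: real_norm_def norm_one mult_1_right)
          then show "(\<mu> n)\<^sup>2 * l n * (l n / h n) \<le> c" by linarith
        qed
        moreover have "T n w \<le> (2 * chaining_const + 2) * (C + 3) + \<bar>\<mu> n\<bar> * l n / sqrt (h n)"
          unfolding T_def Y_def l_def using C ln
          by (intro DS_stat_upper_bound[OF elim(2) that]) auto
        ultimately show ?thesis
          using T_nonneg[OF elim(2), of w] signal[OF elim(2)] unfolding K_def by linarith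
      qed
      then have "prob {w \<in> space (M n). \<bar>T n w\<bar> > K} \<le> prob ?Bad"
        using bad(1) by (intro finite_measure_mono) (auto simp: not_le[symmetric])
      then show ?case using bad(2) C by linarith
    qed
    then show "\<exists>C. \<forall>\<^sub>F n in sequentially. \<P>(w in M n. \<bar>T n w\<bar> > C) \<le> \<epsilon>" by blast
  qed

  have not_consistent: "\<not> consistent_test M T" if "bounded_in_prob M T"
  proof
    assume cons: "consistent_test M T"
    have "\<exists>C. \<forall>\<^sub>F n in sequentially. \<P>(w in M n. \<bar>T n w\<bar> > C) \<le> 1 / 2"
      using that unfolding bounded_in_prob_def by (elim conjE allE[of _ "1 / 2"]) simp
    then obtain C where C: "\<forall>\<^sub>F n in sequentially. \<P>(w in M n. \<bar>T n w\<bar> > C) \<le> 1 / 2" ..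
    \<comment> \<open>Consistency concerns positive critical values only, and \<open>C\<close> need
      not be positive.\<close>
    have "(\<lambda>n. \<P>(w in M n. T n w > max C 1)) \<longlonglongrightarrow> 1"
      using cons unfolding consistent_test_def by (simp del: max_less_iff_conj)
    then have "\<forall>\<^sub>F n in sequentially. 1 / 2 < \<P>(w in M n. T n w > max C 1)"
      by (rule order_tendstoD) simp
    with C eventually_ge_at_top[of 1] have "\<forall>\<^sub>F n in sequentially. False"
    proof eventually_elim
      case (elim n)
      interpret prob_space "M n" by (rule prob) fact
      have [measurable]: "T n \<in> borel_measurable (M n)" by (rule T_meas) fact
      have "prob {w \<in> space (M n). T n w > max C 1} \<le> prob {w \<in> space (M n). \<bar>T n w\<bar> > C}"
        by (intro finite_measure_mono) auto
      then show ?case using elim by linarith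
    qed
    then show False by simp
  qed

  show ?thesis
    using part_i part_ii not_consistent T_meas_ev
    by (auto simp: tends_to_infinity_in_prob_def consistent_test_def)
qed

end
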